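(* Let $n\geq2$, let $X$ be the $n$-adic Cantor set obtained from $[0,1]$, and let $(C(X),\mathbb{Q}_n\times_\delta\mathbb{Z},\alpha)$ be Hopenwasser's partial dynamical system (described in the context), whose crossed product is isomorphic to the Cuntz algebra $\mathcal{O}_n$. Then every nonempty clopen subset of $X$ is $(\mathbb{Q}_n\times_\delta\mathbb{Z},\tau_X)$-paradoxical.
   Context: $\mathbb{Q}_n=\{p/n^k:p\in\mathbb{Z},k\in\mathbb{N}\cup\{0\}\}$ is the group of $n$-adic rationals, and $\mathbb{Q}_n\times_\delta\mathbb{Z}=\{(r,k):r\in\mathbb{Q}_n,k\in\mathbb{Z}\}$ is the semidirect product with operations $(s,j)(r,k)=(\frac{r}{n^j}+s,\,j+k)$ and $(r,k)^{-1}=(-n^kr,-k)$. The space $X$: let $\widetilde{\mathbb{R}}$ be obtained from $\mathbb{R}$ by replacing each $n$-adic rational $r$ with a pair $r^-<r^+$, where $r^-$ is the immediate predecessor of $r^+$, with the resulting linear order and the order topology. Let $X=\{y\in\widetilde{\mathbb{R}}:0^+\leq y\leq1^-\}$. (So $X$ is $[0,1]$ with each $n$-adic rational other than $0$ and $1$ split in two; $0^+$ and $1^-$ are identified with $0$ and $1$.) $X$ is a Cantor set and the intervals $[(p/n^k)^+,(q/n^l)^-]$ form a basis of compact open sets. The partial action: the group $G=\mathbb{Q}_n\times_\delta\mathbb{Z}$ acts on $\widetilde{\mathbb{R}}$ by homeomorphisms via the affine maps $(r,k)\cdot y=\frac{y}{n^k}+r$ (preserving the signs $\pm$ on split points). The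 partial action $\theta$ of $G$ on $X$ is its restriction: $X_g=X\cap g\cdot X$ and $\theta_g:X_{g^{-1}}\to X_g$, $\theta_g(y)=g\cdot y$. It induces the partial action $\alpha$ of $G$ on $C(X)$ by $\alpha_g(f)=f\circ\theta_{g^{-1}}$ for $f\in C_0(X_{g^{-1}})$. Paradoxicality: $\tau_X$ denotes the topology of $X$. A nonempty set $V\subseteq X$ is $(G,\tau_X)$-paradoxical if there exist $a,b\geq1$, open sets $V_1,\dots,V_{a+b}\in\tau_X$ and elements $t_1,\dots,t_{a+b}\in G$ such that $\bigcup_{i=1}^aV_i=\bigcup_{i=a+1}^{a+b}V_i=V$, $V_i\subseteq X_{t_i^{-1}}$ and $\theta_{t_i}(V_i)\subseteq V$ for all $i$, and $\theta_{t_k}(V_k)\cap\theta_{t_l}(V_l)=\emptyset$ for $k\neq l$. *)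

theory Defs
  imports "HOL-Analysis.Analysis" "HOL-Algebra.Group"
begin

section \<open>The group of \<open>n\<close>-adic rationals and its semidirect product with the integers\<close>

definition nadic :: "nat \<Rightarrow> real set" where
  "nadic n = {real_of_int p / real n ^ k | p k. True}"

definition nadic_semidirect :: "nat \<Rightarrow> (real \<times> int) monoid" where
  "nadic_semidirect n =
     \<lparr>carrier = nadic n \<times> UNIV,
      mult = (\<lambda>(s, j) (r, k). (r / real n powi j + s, j + k)),
      one = (0, 0)\<rparr>"

lemma nadic_add:
  assumes n: "n \<ge> 1" and "r \<in> nadic n" "s \<in> nadic n"
  shows "r + s \<in> nadic n"
proof -
  obtain p k q l where r: "r = real_of_int p / real n ^ k" and s: "s = real_of_int q / real n ^ l"
    using assms by (auto simp: nadic_def)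
  have "r + s = real_of_int (p * int n ^ l + q * int n ^ k) / real n ^ (k + l)"
    using n by (simp add: r s field_simps power_add)
  then show ?thesis
    unfolding nadic_def by blast
qed

lemma nadic_uminus:
  assumes "r \<in> nadic n"
  shows "- r \<in> nadic n"
proof -
  obtain p k where r: "r = real_of_int p / real n ^ k"
    using assms by (auto simp: nadic_def)
  have "- r = real_of_int (- p) / real n ^ k"
    by (simp add: r)
  then show ?thesis
    unfolding nadic_def by blast
qed

lemma nadic_mult_powi:
  assumes n: "n \<ge> 1" and "r \<in> nadic n"
  shows "real n powi j * r \<in> nadic n"
proof -
  obtain p k where r: "r = real_of_int p / real n ^ k"
    using assms by (auto simp: nadic_def)
  show ?thesis
  proof (cases "j \<ge> 0")
    case True
    then have "real n powi j * r = real_of_int (int n ^ nat j * p) / real n ^ k"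
      by (simp add: r power_int_def)
    then show ?thesis
      unfolding nadic_def by blast
  next
    case False
    then have "real n powi j * r = real_of_int p / real n ^ (k + nat (- j))"
      by (simp add: r power_int_def power_add field_simps)
    then show ?thesis
      unfolding nadic_def by blast
  qed
qed

lemma nadic_divide_powi:
  assumes "n \<ge> 1" and "r \<in> nadic n"
  shows "r / real n powi j \<in> nadic n"
  using nadic_mult_powi[OF assms, of "- j"] by (simp add: power_int_minus field_simps)

lemma zero_in_nadic: "0 \<in> nadic n"
  unfolding nadic_def by (auto intro!: exI[of _ "0::int"])

lemma group_nadic_semidirect:
  assumes n: "n \<ge> 1"
  shows "group (nadic_semidirect n)"
proof (rule groupI)
  fix x y assume "x \<in> carrier (nadic_semidirect n)" "y \<in> carrier (nadic_semidirect n)"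
  then show "x \<otimes>\<^bsub>nadic_semidirect n\<^esub> y \<in> carrier (nadic_semidirect n)"
    using n by (auto simp: nadic_semidirect_def intro!: nadic_add nadic_divide_powi)
next
  fix x y z :: "real \<times> int"
  show "x \<otimes>\<^bsub>nadic_semidirect n\<^esub> y \<otimes>\<^bsub>nadic_semidirect n\<^esub> z =
        x \<otimes>\<^bsub>nadic_semidirect n\<^esub> (y \<otimes>\<^bsub>nadic_semidirect n\<^esub> z)"
    using n by (auto simp: nadic_semidirect_def power_int_add field_simps split: prod.splits)
next
  fix x assume x: "x \<in> carrier (nadic_semidirect n)"
  obtain r k where rk: "x = (r, k)" by (cases x)
  show "\<exists>y\<in>carrier (nadic_semidirect n). y \<otimes>\<^bsub>nadic_semidirect n\<^esub> x = \<one>\<^bsub>nadic_semidirect n\<^esub>"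
  proof (rule bexI[of _ "(- (real n powi k) * r, - k)"])
    show "(- (real n powi k) * r, - k) \<in> carrier (nadic_semidirect n)"
      using x n nadic_uminus[OF nadic_mult_powi[of n r k]]
      by (auto simp: nadic_semidirect_def rk)
  qed (use n in \<open>auto simp: nadic_semidirect_def rk power_int_minus field_simps\<close>)
qed (auto simp: nadic_semidirect_def zero_in_nadic)

lemma inv_nadic_semidirect:
  assumes n: "n \<ge> 1" and r: "r \<in> nadic n"
  shows "inv\<^bsub>nadic_semidirect n\<^esub> (r, k) = (- (real n powi k) * r, - k)"
proof -
  interpret group "nadic_semidirect n"
    using n by (rule group_nadic_semidirect)
  show ?thesis
    using n r nadic_uminus[OF nadic_mult_powi[of n r k]]
    by (intro inv_equality) (auto simp: nadic_semidirect_def power_int_minus field_simps)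
qed

section \<open>The line with split \<open>n\<close>-adic points\<close>

datatype 'a split_point =
    Whole (base: 'a)
  | Minus (base: 'a)
  | Plus (base: 'a)

definition split_less :: "real split_point \<Rightarrow> real split_point \<Rightarrow> bool" where
  "split_less y z \<longleftrightarrow> base y < base z \<or> (\<exists>r. y = Minus r \<and> z = Plus r)"

definition split_le :: "real split_point \<Rightarrow> real split_point \<Rightarrow> bool" where
  "split_le y z \<longleftrightarrow> y = z \<or> split_less y z"

definition split_line :: "nat \<Rightarrow> real split_point set" where
  "split_line n = Whole ` (- nadic n) \<union> Minus ` nadic n \<union> Plus ` nadic n"

text \<open>The open rays of \<open>split_line n\<close> are a subbasis of the order topology, and cover
  \<open>split_line n\<close> because the order has no endpoints.\<close>

definition split_line_topology :: "nat \<Rightarrow> real split_point topology" where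
  "split_line_topology n = topology_generated_by
     ((\<lambda>a. {y \<in> split_line n. split_less a y}) ` split_line n \<union>
      (\<lambda>a. {y \<in> split_line n. split_less y a}) ` split_line n)"

definition nadic_cantor :: "nat \<Rightarrow> real split_point set" where
  "nadic_cantor n = {y \<in> split_line n. split_le (Plus 0) y \<and> split_le y (Minus 1)}"

definition nadic_cantor_topology :: "nat \<Rightarrow> real split_point topology" where
  "nadic_cantor_topology n = subtopology (split_line_topology n) (nadic_cantor n)"

section \<open>The partial action\<close>

definition affine_act :: "nat \<Rightarrow> real \<times> int \<Rightarrow> real split_point \<Rightarrow> real split_point" where
  "affine_act n = (\<lambda>(r, k). map_split_point (\<lambda>x. x / real n powi k + r))"

definition partial_dom :: "nat \<Rightarrow> real \<times> int \<Rightarrow> real split_point set" where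
  "partial_dom n g = nadic_cantor n \<inter> affine_act n g ` nadic_cantor n"

definition partial_act :: "nat \<Rightarrow> real \<times> int \<Rightarrow> real split_point \<Rightarrow> real split_point" where
  "partial_act n g =
     restrict (affine_act n g) (partial_dom n (inv\<^bsub>nadic_semidirect n\<^esub> g))"

section \<open>Paradoxical sets\<close>

text \<open>Here \<open>D g\<close> is the range of the partial homeomorphism \<open>\<theta> g\<close>, whose domain is
  therefore \<open>D (inv g)\<close>.\<close>

definition paradoxical ::
    "('g, 'm) monoid_scheme \<Rightarrow> 'x topology \<Rightarrow> ('g \<Rightarrow> 'x set) \<Rightarrow> ('g \<Rightarrow> 'x \<Rightarrow> 'x) \<Rightarrow> 'x set \<Rightarrow> bool" where
  "paradoxical G \<tau> D \<theta> V \<longleftrightarrow>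
     V \<noteq> {} \<and> V \<subseteq> topspace \<tau> \<and>
     (\<exists>a b :: nat. \<exists>U :: nat \<Rightarrow> 'x set. \<exists>t :: nat \<Rightarrow> 'g.
        a \<ge> 1 \<and> b \<ge> 1 \<and>
        (\<forall>i\<in>{1..a + b}. openin \<tau> (U i) \<and> t i \<in> carrier G) \<and>
        (\<Union>i\<in>{1..a}. U i) = V \<and> (\<Union>i\<in>{a + 1..a + b}. U i) = V \<and>
        (\<forall>i\<in>{1..a + b}. U i \<subseteq> D (inv\<^bsub>G\<^esub> (t i)) \<and> \<theta> (t i) ` U i \<subseteq> V) \<and>
        (\<forall>k\<in>{1..a + b}. \<forall>l\<in>{1..a + b}. k \<noteq> l \<longrightarrow> \<theta> (t k) ` U k \<inter> \<theta> (t l) ` U l = {}))"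

end

theory Submission
  imports Defs
begin

text \<open>A nonempty open set \<open>V\<close> contains a cell \<open>[(p/n^k)\<^sup>+, ((p+1)/n^k)\<^sup>-]\<close>. Two distinct
  cells of level \<open>k + 1\<close> inside it are images of the whole space \<open>X\<close> under group elements, so these
  two elements carry \<open>V\<close> itself into disjoint subsets of \<open>V\<close>, and one can take \<open>a = b = 1\<close>.\<close>

text \<open>A point lies in \<open>[(p/n^k)\<^sup>+, ((p+1)/n^k)\<^sup>-]\<close> iff its cell index of level \<open>k\<close> is \<open>p\<close>.\<close>

fun cell_index :: "nat \<Rightarrow> nat \<Rightarrow> real split_point \<Rightarrow> int" where
  "cell_index n k (Whole x) = \<lfloor>x * real n ^ k\<rfloor>"
| "cell_index n k (Plus x) = \<lfloor>x * real n ^ k\<rfloor>"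
| "cell_index n k (Minus x) = \<lceil>x * real n ^ k\<rceil> - 1"

section \<open>Geometry of cells and their behaviour under affine maps\<close>

lemma cell_index_le_base: "real_of_int (cell_index n k y) \<le> base y * real n ^ k"
  by (cases y) (simp; linarith)+

lemma base_le_cell_index: "base y * real n ^ k \<le> real_of_int (cell_index n k y) + 1"
  by (cases y) (simp; linarith)+

lemma dist_base_le_of_same_cell:
  assumes "n \<ge> 1" and "cell_index n k z = cell_index n k y"
  shows "\<bar>base z - base y\<bar> \<le> 1 / real n ^ k"
proof -
  have "\<bar>base z * real n ^ k - base y * real n ^ k\<bar> \<le> 1"
    using assms(2) cell_index_le_base[of n k z] cell_index_le_base[of n k y]
      base_le_cell_index[of z n k] base_le_cell_index[of y n k] by linarith
  moreover have "\<bar>base z * real n ^ k - base y * real n ^ k\<bar> = \<bar>base z - base y\<bar> * real n ^ k"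
    by (simp add: abs_mult left_diff_distrib[symmetric])
  ultimately show ?thesis
    using assms(1) by (simp add: field_simps)
qed

text \<open>Multiplying by \<open>n ^ (k + m)\<close> clears the denominator of the translation, and
  both floor and ceiling commute with the resulting integer shift.\<close>

lemma cell_index_affine_act:
  assumes "n \<ge> 1"
  shows "cell_index n (k + m) (affine_act n (real_of_int p / real n ^ k, int k) y) =
    p * int n ^ m + cell_index n m y"
proof -
  have *: "(x / real n ^ k + real_of_int p / real n ^ k) * real n ^ (k + m) =
      x * real n ^ m + real_of_int (p * int n ^ m)" for x :: real
    using assms by (simp add: power_add field_simps)
  show ?thesis
    by (cases y) (simp only: affine_act_def prod.case split_point.map cell_index.simps
        power_int_of_nat * floor_add_int[symmetric] ceiling_add_of_int; simp)+
qed

text \<open>Cells are nested: each cell of level \<open>k\<close> splits into \<open>n ^ m\<close>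
  consecutive cells of level \<open>k + m\<close>. For the floor this is integer division by
  \<open>n ^ m\<close>; the left-hand points need the analogue for ceiling minus one.\<close>

lemma cell_index_div:
  assumes "n \<ge> 1"
  shows "cell_index n (k + m) y div int n ^ m = cell_index n k y"
proof -
  define N where "N = int n ^ m"
  have N: "N > 0"
    using assms by (simp add: N_def)
  have split: "x * real n ^ k = (x * real n ^ (k + m)) / real_of_int N" for x
    using assms by (simp add: N_def power_add)
  have fl: "\<lfloor>u / real_of_int N\<rfloor> = \<lfloor>u\<rfloor> div N" for u :: real
    using N by (intro floor_divide_real_eq_div) simp
  have ce: "\<lceil>u / real_of_int N\<rceil> - 1 = (\<lceil>u\<rceil> - 1) div N" for u :: real
  proof -
    have "\<lceil>u / real_of_int N\<rceil> = - (\<lfloor>- u\<rfloor> div N)"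
      using fl[of "- u"] by (simp add: ceiling_def)
    also have "\<dots> = - ((- \<lceil>u\<rceil>) div N)"
      by (simp add: ceiling_def)
    \<comment> \<open>Negating the division of \<open>\<lceil>u\<rceil> - 1\<close> by
      \<open>N\<close> turns its remainder \<open>s\<close> into \<open>N - 1 - s\<close>, which
      again lies between \<open>0\<close> and \<open>N - 1\<close>.\<close>
    also have "(- \<lceil>u\<rceil>) div N = - ((\<lceil>u\<rceil> - 1) div N + 1)"
    proof (rule int_div_pos_eq)
      show "- \<lceil>u\<rceil> = N * - ((\<lceil>u\<rceil> - 1) div N + 1) + (N - 1 - (\<lceil>u\<rceil> - 1) mod N)"
        using mult_div_mod_eq[of N "\<lceil>u\<rceil> - 1"] by (simp add: algebra_simps)
    qed (use N pos_mod_bound[of N "\<lceil>u\<rceil> - 1"] pos_mod_sign[of N "\<lceil>u\<rceil> - 1"] in linarith)+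
    finally show ?thesis by simp
  qed
  show ?thesis
    unfolding N_def[symmetric]
    by (cases y) (simp_all only: cell_index.simps split[of _] fl ce)
qed

text \<open>The affine map preserves being \<open>n\<close>-adic in both directions; the converse
  direction keeps unsplit points unsplit.\<close>

lemma affine_act_split_line:
  assumes n: "n \<ge> 1" and r: "r \<in> nadic n" and y: "y \<in> split_line n"
  shows "affine_act n (r, k) y \<in> split_line n"
proof -
  have "x / real n powi k + r \<in> nadic n \<longleftrightarrow> x \<in> nadic n" for x
  proof
    assume "x / real n powi k + r \<in> nadic n"
    from nadic_mult_powi[OF n nadic_add[OF n this nadic_uminus[OF r]], of k]
    have "real n powi k * ((x / real n powi k + r) + - r) \<in> nadic n" .
    then show "x \<in> nadic n"
      using n by simp
  next
    assume "x \<in> nadic n"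
    then show "x / real n powi k + r \<in> nadic n"
      using n r by (intro nadic_add nadic_divide_powi)
  qed
  then show ?thesis
    using y by (auto simp: split_line_def affine_act_def)
qed

lemma affine_act_inv:
  assumes "n \<ge> 1" and "r \<in> nadic n"
  shows "affine_act n (inv\<^bsub>nadic_semidirect n\<^esub> (r, k)) (affine_act n (r, k) y) = y"
  using assms
  by (cases y) (simp_all add: inv_nadic_semidirect affine_act_def power_int_minus field_simps)

section \<open>The space \<open>X\<close> as an open set and as a cell\<close>

text \<open>\<open>Minus 0\<close> immediately precedes \<open>Plus 0\<close> and
  \<open>Plus 1\<close> immediately follows \<open>Minus 1\<close>, so the closed interval is also
  an open one.\<close>

lemma nadic_cantor_eq_rays:
  "nadic_cantor n =
    {y \<in> split_line n. split_less (Minus 0) y} \<inter> {y \<in> split_line n. split_less y (Plus 1)}"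
  by (auto simp: nadic_cantor_def split_line_def split_le_def split_less_def zero_in_nadic)

lemma one_in_nadic: "1 \<in> nadic n"
  unfolding nadic_def by (auto intro!: exI[of _ "1::int"] exI[of _ "0::nat"])

lemma nadic_cantor_iff_cell_index:
  "y \<in> nadic_cantor n \<longleftrightarrow> y \<in> split_line n \<and> cell_index n 0 y = 0"
  using zero_in_nadic[of n] one_in_nadic[of n]
  by (cases y) (auto simp: nadic_cantor_def split_line_def split_le_def split_less_def
    floor_eq_iff ceiling_eq_iff order_less_le)

lemma openin_nadic_cantor: "openin (split_line_topology n) (nadic_cantor n)"
  unfolding nadic_cantor_eq_rays split_line_topology_def
  by (intro openin_Int topology_generated_by_Basis)
    (auto simp: split_line_def zero_in_nadic one_in_nadic)

section \<open>Cells as arbitrarily small neighbourhoods\<close>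

text \<open>From some level on, \<open>r\<close> is an endpoint of cells, so \<open>Minus r\<close>
  and \<open>Plus r\<close> lie in different cells.\<close>

lemma nadic_scaled_int:
  assumes "n \<ge> 1" and "r \<in> nadic n"
  shows "eventually (\<lambda>k. \<exists>q. r * real n ^ k = real_of_int q) sequentially"
proof -
  obtain p j where r: "r = real_of_int p / real n ^ j"
    using assms by (auto simp: nadic_def)
  have "r * real n ^ k = real_of_int (p * int n ^ (k - j))" if "k \<ge> j" for k
    using assms(1) that by (simp add: r field_simps flip: power_add)
  then show ?thesis
    unfolding eventually_sequentially by blast
qed

lemma eventually_inverse_power_less:
  assumes "n \<ge> 2" and "e > 0"
  shows "eventually (\<lambda>k. 1 / real n ^ k < e) sequentially"
proof -
  have "(\<lambda>k. (1 / real n) ^ k) \<longlonglongrightarrow> 0"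
    using assms by (intro LIMSEQ_realpow_zero) auto
  from order_tendstoD(2)[OF this assms(2)] show ?thesis
    by (simp add: power_one_over)
qed

lemma eventually_cell_subset_upper_ray:
  assumes n: "n \<ge> 2" and y: "y \<in> split_line n" and ay: "split_less a y"
  shows "eventually (\<lambda>k. \<forall>z\<in>split_line n. cell_index n k z = cell_index n k y \<longrightarrow> split_less a z)
    sequentially"
proof (cases "base a < base y")
  case True
  then have "eventually (\<lambda>k. 1 / real n ^ k < base y - base a) sequentially"
    using n by (intro eventually_inverse_power_less) auto
  then show ?thesis
  proof eventually_elim
    case (elim k)
    show ?case
    proof (intro ballI impI)
      fix z assume "cell_index n k z = cell_index n k y"
      then have "\<bar>base z - base y\<bar> \<le> 1 / real n ^ k"
        using n by (intro dist_base_le_of_same_cell) auto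
      then have "base a < base z"
        using elim by linarith
      then show "split_less a z"
        by (simp add: split_less_def)
    qed
  qed
next
  case False
  \<comment> \<open>The bases coincide here, so small cells alone do not suffice; instead
    \<open>r\<close> must become the left endpoint of the cell of \<open>y\<close>.\<close>
  then obtain r where a: "a = Minus r" and yr: "y = Plus r"
    using ay by (auto simp: split_less_def)
  then have r: "r \<in> nadic n"
    using y by (auto simp: split_line_def)
  have "eventually (\<lambda>k. \<exists>q. r * real n ^ k = real_of_int q) sequentially"
    using n r by (intro nadic_scaled_int) auto
  then show ?thesis
  proof eventually_elim
    case (elim k)
    then obtain q where q: "r * real n ^ k = real_of_int q" by blast
    show ?case
    proof (intro ballI impI)
      fix z assume z: "z \<in> split_line n" and "cell_index n k z = cell_index n k y"
      then have zq: "cell_index n k z = q"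
        by (simp add: yr q)
      then have "r * real n ^ k \<le> base z * real n ^ k"
        using cell_index_le_base[of n k z] by (simp add: q)
      then have "r \<le> base z"
        using n by simp
      \<comment> \<open>\<open>Minus r\<close> has index \<open>q - 1\<close>, in the neighbouring
        cell on the left.\<close>
      moreover have "z \<noteq> Minus r"
        using zq cell_index.simps(3)[of n k r] by (auto simp: q)
      ultimately show "split_less a z"
        using z r by (cases z) (auto simp: a split_less_def split_line_def order_less_le)
    qed
  qed
qed

lemma eventually_cell_subset_lower_ray:
  assumes n: "n \<ge> 2" and y: "y \<in> split_line n" and ya: "split_less y a"
  shows "eventually (\<lambda>k. \<forall>z\<in>split_line n. cell_index n k z = cell_index n k y \<longrightarrow> split_less z a)
    sequentially"
proof (cases "base y < base a")
  case True
  then have "eventually (\<lambda>k. 1 / real n ^ k < base a - base y) sequentially"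
    using n by (intro eventually_inverse_power_less) auto
  then show ?thesis
  proof eventually_elim
    case (elim k)
    show ?case
    proof (intro ballI impI)
      fix z assume "cell_index n k z = cell_index n k y"
      then have "\<bar>base z - base y\<bar> \<le> 1 / real n ^ k"
        using n by (intro dist_base_le_of_same_cell) auto
      then have "base z < base a"
        using elim by linarith
      then show "split_less z a"
        by (simp add: split_less_def)
    qed
  qed
next
  case False
  then obtain r where a: "a = Plus r" and yr: "y = Minus r"
    using ya by (auto simp: split_less_def)
  then have r: "r \<in> nadic n"
    using y by (auto simp: split_line_def)
  have "eventually (\<lambda>k. \<exists>q. r * real n ^ k = real_of_int q) sequentially"
    using n r by (intro nadic_scaled_int) auto
  then show ?thesis
  proof eventually_elim
    case (elim k)
    then obtain q where q: "r * real n ^ k = real_of_int q" by blast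
    show ?case
    proof (intro ballI impI)
      fix z assume z: "z \<in> split_line n" and "cell_index n k z = cell_index n k y"
      then have zq: "cell_index n k z = q - 1"
        by (simp add: yr q)
      then have "base z * real n ^ k \<le> r * real n ^ k"
        using base_le_cell_index[of z n k] by (simp add: q)
      then have "base z \<le> r"
        using n by simp
      moreover have "z \<noteq> Plus r"
        using zq q by auto
      ultimately show "split_less z a"
        using z r by (cases z) (auto simp: a split_less_def split_line_def order_less_le)
    qed
  qed
qed

text \<open>Induction over the generation of the topology from rays. Stating the claim for all large
  \<open>k\<close>, not just for some \<open>k\<close>, lets two levels be combined in the
  intersection case.\<close>

lemma eventually_cell_subset_open:
  assumes n: "n \<ge> 2" and W: "openin (split_line_topology n) W"
    and y: "y \<in> W" "y \<in> split_line n"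
  shows "eventually (\<lambda>k. \<forall>z\<in>split_line n. cell_index n k z = cell_index n k y \<longrightarrow> z \<in> W)
    sequentially"
proof -
  have "generate_topology_on
     ((\<lambda>a. {y \<in> split_line n. split_less a y}) ` split_line n \<union>
      (\<lambda>a. {y \<in> split_line n. split_less y a}) ` split_line n) W"
    using W by (simp add: split_line_topology_def openin_topology_generated_by_iff)
  then show ?thesis
    using y
  proof (induction W)
    case Empty
    then show ?case by simp
  next
    case (Int A B)
    then have "eventually (\<lambda>k. \<forall>z\<in>split_line n. cell_index n k z = cell_index n k y \<longrightarrow> z \<in> A)
        sequentially"
      and "eventually (\<lambda>k. \<forall>z\<in>split_line n. cell_index n k z = cell_index n k y \<longrightarrow> z \<in> B)
        sequentially"
      by auto
    then show ?case
      by eventually_elim auto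
  next
    case (UN K)
    then obtain A where "A \<in> K" and
      "eventually (\<lambda>k. \<forall>z\<in>split_line n. cell_index n k z = cell_index n k y \<longrightarrow> z \<in> A) sequentially"
      by blast
    then show ?case
      by (auto elim!: eventually_mono)
  next
    case (Basis A)
    then show ?case
      using eventually_cell_subset_upper_ray[OF n, of y] eventually_cell_subset_lower_ray[OF n, of y]
      by (auto elim!: eventually_mono)
  qed
qed

section \<open>Two disjoint copies of \<open>V\<close> inside \<open>V\<close>\<close>

text \<open>The case \<open>a = b = 1\<close> with both pieces equal to \<open>V\<close>; the
  indices \<open>0, 1\<close> of \<open>t\<close> are shifted to \<open>1, 2\<close>.\<close>

lemma paradoxicalI_two:
  assumes "V \<noteq> {}" and V: "openin \<tau> V"
    and "\<And>i. i \<in> {0, 1::nat} \<Longrightarrow> t i \<in> carrier G \<and> V \<subseteq> D (inv\<^bsub>G\<^esub> (t i)) \<and> \<theta> (t i) ` V \<subseteq> V"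
    and "\<theta> (t 0) ` V \<inter> \<theta> (t 1) ` V = {}"
  shows "paradoxical G \<tau> D \<theta> V"
proof -
  have *: "{1..1 + 1} = {1, 2::nat}" "{1 + 1..1 + 1} = {2::nat}" "{1..1} = {1::nat}" by auto
  have "V \<subseteq> topspace \<tau>"
    using V by (rule openin_subset)
  then show ?thesis
    unfolding paradoxical_def
    by (intro conjI assms(1), assumption)
      (rule exI[of _ 1], rule exI[of _ 1], rule exI[of _ "\<lambda>_. V"],
        rule exI[of _ "\<lambda>i. t (i - 1)"],
        use assms(3)[of 0] assms(3)[of 1] assms(4) V in \<open>auto simp: *[simplified]\<close>)
qed

theorem proposition5p2:
  fixes n :: nat and V :: "real split_point set"
  assumes "n \<ge> 2"
    and "V \<noteq> {}"
    and "openin (nadic_cantor_topology n) V"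
    and "closedin (nadic_cantor_topology n) V"
  shows "paradoxical (nadic_semidirect n) (nadic_cantor_topology n)
           (partial_dom n) (partial_act n) V"
proof -
  have n: "n \<ge> 1"
    using assms(1) by simp
  have V: "openin (split_line_topology n) V" and VX: "V \<subseteq> nadic_cantor n"
    using assms(3) openin_nadic_cantor[of n]
    by (auto simp: nadic_cantor_topology_def openin_open_subtopology)
  obtain y where y: "y \<in> V"
    using assms(2) by blast
  then have "y \<in> split_line n"
    using VX by (auto simp: nadic_cantor_def)
  from eventually_cell_subset_open[OF assms(1) V y this]
  obtain k where k: "\<And>z. z \<in> split_line n \<Longrightarrow> cell_index n k z = cell_index n k y \<Longrightarrow> z \<in> V"
    by (auto simp: eventually_sequentially)
  \<comment> \<open>For \<open>i = 0, 1\<close> these are the first two of the \<open>n\<close>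
    cells of level \<open>k + 1\<close> inside the cell of \<open>y\<close>; \<open>t i\<close>
    shrinks \<open>X\<close> by \<open>n ^ (k + 1)\<close> and moves its left end to
    \<open>r i\<close>.\<close>
  define p where "p i = cell_index n k y * int n + int i" for i :: nat
  define r where "r i = real_of_int (p i) / real n ^ (k + 1)" for i
  define t where "t i = (r i, int (k + 1))" for i
  have r: "r i \<in> nadic n" for i
    unfolding r_def nadic_def by blast
  \<comment> \<open>Points of \<open>X\<close> have index \<open>0\<close> at level
    \<open>0\<close>, so only the shift \<open>p i\<close> remains.\<close>
  have index: "cell_index n (k + 1) (affine_act n (t i) z) = p i" if "z \<in> V" for z i
    using that VX cell_index_affine_act[OF n, of "k + 1" 0 "p i" z]
    by (auto simp: t_def r_def nadic_cantor_iff_cell_index)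
  have into: "affine_act n (t i) z \<in> V" if z: "z \<in> V" and i: "i \<in> {0, 1}" for z i
  proof (rule k)
    show "affine_act n (t i) z \<in> split_line n"
      unfolding t_def using z VX by (intro affine_act_split_line n r) (auto simp: nadic_cantor_def)
    have "cell_index n k (affine_act n (t i) z) = p i div int n"
      using cell_index_div[OF n, of k 1 "affine_act n (t i) z"] index[OF z, of i] by simp
    \<comment> \<open>Here \<open>n \<ge> 2\<close> enters: the offset \<open>1\<close> is still
      smaller than \<open>n\<close>.\<close>
    also have "\<dots> = cell_index n k y"
      using i assms(1) by (auto simp: p_def)
    finally show "cell_index n k (affine_act n (t i) z) = cell_index n k y" .
  qed
  have dom: "V \<subseteq> partial_dom n (inv\<^bsub>nadic_semidirect n\<^esub> (t i))" if i: "i \<in> {0, 1}" for i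
  proof
    fix z assume z: "z \<in> V"
    \<comment> \<open>This exhibits \<open>z\<close> as the image under the inverse of a point of
      \<open>V\<close>, hence of \<open>X\<close>.\<close>
    have "z = affine_act n (inv\<^bsub>nadic_semidirect n\<^esub> (t i)) (affine_act n (t i) z)"
      unfolding t_def using n r by (simp only: affine_act_inv)
    then show "z \<in> partial_dom n (inv\<^bsub>nadic_semidirect n\<^esub> (t i))"
      unfolding partial_dom_def using z VX into[OF z i] by blast
  qed
  have image: "partial_act n (t i) ` V = affine_act n (t i) ` V" if "i \<in> {0, 1}" for i
    unfolding partial_act_def using dom[OF that] by (intro image_cong) auto
  show ?thesis
  proof (rule paradoxicalI_two[where t = t])
    show "t i \<in> carrier (nadic_semidirect n) \<and>
        V \<subseteq> partial_dom n (inv\<^bsub>nadic_semidirect n\<^esub> (t i)) \<and> partial_act n (t i) ` V \<subseteq> V"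
      if "i \<in> {0, 1}" for i
      using dom[OF that] image[OF that] into that r
      by (auto simp: nadic_semidirect_def t_def)
    \<comment> \<open>The two images lie in cells with different indices \<open>p 0\<close> and
      \<open>p 1\<close>.\<close>
    have "affine_act n (t 0) z \<noteq> affine_act n (t 1) w" if "z \<in> V" "w \<in> V" for z w
      using index[OF that(1), of 0] index[OF that(2), of 1] by (auto simp: p_def)
    then show "partial_act n (t 0) ` V \<inter> partial_act n (t 1) ` V = {}"
      by (auto simp: image)
  qed (use assms in auto)
qed

end
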